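(* Let $G$ be a finite connected vertex-transitive graph of degree $d$, and let $\mu$ be a simple eigenvalue (i.e. of multiplicity one) of its normalized adjacency matrix $D^{-1}A$. Then $\mu=\frac{2k}{d}-1$ for some integer $k$ with $0\le k\le d$.
   Context: Graphs are finite, simple and undirected, without isolated vertices. A vertex-transitive graph is regular; $d$ is its common vertex degree. $D$ is the diagonal degree matrix and $A$ the adjacency matrix ($A_{ij}=1$ if $\{i,j\}$ is an edge, else $0$). *)

theory Defs
  imports
    "Graph_Theory.Digraph_Isomorphism"
    "Jordan_Normal_Form.Gauss_Jordan_Elimination"
    "Jordan_Normal_Form.Char_Poly"
begin

text \<open>
  Simple undirected graphs are the digraphs of the locale \<^locale>\<open>graph\<close>: finite, loop-free,
  without parallel arcs, symmetric.  Each undirected edge is a pair of opposite arcs, so the degree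
  of a vertex is its \<^const>\<open>out_degree\<close>.
\<close>

definition automorphism ::
    "('a,'b) pre_digraph \<Rightarrow> ('a,'b,'a,'b) digraph_isomorphism \<Rightarrow> bool" where
  "automorphism G f \<longleftrightarrow> pre_digraph.digraph_isomorphism G f \<and> app_iso f G = G"

definition vertex_transitive :: "('a,'b) pre_digraph \<Rightarrow> bool" where
  "vertex_transitive G \<longleftrightarrow>
     (\<forall>u\<in>verts G. \<forall>v\<in>verts G. \<exists>f. automorphism G f \<and> iso_verts f u = v)"

text \<open>For simple graphs, an automorphism is just an adjacency-preserving vertex permutation.\<close>

lemma vertex_transitive_iff:
  assumes "graph G"
  shows "vertex_transitive G \<longleftrightarrow>
    (\<forall>u\<in>verts G. \<forall>v\<in>verts G. \<exists>p. bij_betw p (verts G) (verts G) \<and>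
       (\<forall>x\<in>verts G. \<forall>y\<in>verts G. x \<rightarrow>\<^bsub>G\<^esub> y \<longleftrightarrow> p x \<rightarrow>\<^bsub>G\<^esub> p y) \<and> p u = v)"
proof -
  interpret graph G by (rule assms)
  have 1: "bij_betw (iso_verts f) (verts G) (verts G) \<and>
       (\<forall>x\<in>verts G. \<forall>y\<in>verts G. x \<rightarrow>\<^bsub>G\<^esub> y \<longleftrightarrow> iso_verts f x \<rightarrow>\<^bsub>G\<^esub> iso_verts f y)"
    if f: "automorphism G f" for f
  proof -
    have iso: "digraph_isomorphism f" and app: "app_iso f G = G"
      using f by (auto simp: automorphism_def)
    have V: "iso_verts f ` verts G = verts G" and A: "iso_arcs f ` arcs G = arcs G"
      and T: "iso_tail f = tail G" and H: "iso_head f = head G"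
      using app by (metis verts_app_iso, metis arcs_app_iso, metis tail_app_iso, metis head_app_iso)
    have inj: "inj_on (iso_verts f) (verts G)"
      and th: "\<And>a. a \<in> arcs G \<Longrightarrow> iso_verts f (tail G a) = tail G (iso_arcs f a)"
              "\<And>a. a \<in> arcs G \<Longrightarrow> iso_verts f (head G a) = head G (iso_arcs f a)"
      using iso T H by (auto simp: digraph_isomorphism_def)
    have "x \<rightarrow>\<^bsub>G\<^esub> y \<longleftrightarrow> iso_verts f x \<rightarrow>\<^bsub>G\<^esub> iso_verts f y"
      if xy: "x \<in> verts G" "y \<in> verts G" for x y
    proof
      assume "x \<rightarrow>\<^bsub>G\<^esub> y"
      then obtain a where "a \<in> arcs G" "tail G a = x" "head G a = y" by auto
      then show "iso_verts f x \<rightarrow>\<^bsub>G\<^esub> iso_verts f y"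
        using th A by (force simp: arcs_ends_conv)
    next
      assume "iso_verts f x \<rightarrow>\<^bsub>G\<^esub> iso_verts f y"
      then obtain b where b: "b \<in> arcs G" "tail G b = iso_verts f x" "head G b = iso_verts f y"
        by auto
      then obtain a where a: "a \<in> arcs G" "b = iso_arcs f a" using A by auto
      then have "tail G a = x" "head G a = y"
        using b th xy inj by (metis inj_onD tail_in_verts, metis inj_onD head_in_verts)
      then show "x \<rightarrow>\<^bsub>G\<^esub> y" using a by (force simp: arcs_ends_conv)
    qed
    then show ?thesis using V inj by (auto simp: bij_betw_def)
  qed
  have 2: "\<exists>f. automorphism G f \<and> iso_verts f = p"
    if p: "bij_betw p (verts G) (verts G)"
      and adj: "\<forall>x\<in>verts G. \<forall>y\<in>verts G. x \<rightarrow>\<^bsub>G\<^esub> y \<longleftrightarrow> p x \<rightarrow>\<^bsub>G\<^esub> p y" for p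
  proof -
    have "\<exists>b\<in>arcs G. tail G b = p (tail G a) \<and> head G b = p (head G a)"
      if "a \<in> arcs G" for a
    proof -
      have "tail G a \<rightarrow>\<^bsub>G\<^esub> head G a" using that by (auto simp: arcs_ends_conv)
      then have "p (tail G a) \<rightarrow>\<^bsub>G\<^esub> p (head G a)" using adj that by auto
      then show ?thesis by auto
    qed
    then obtain q where q: "\<And>a. a \<in> arcs G \<Longrightarrow> q a \<in> arcs G"
        "\<And>a. a \<in> arcs G \<Longrightarrow> tail G (q a) = p (tail G a)"
        "\<And>a. a \<in> arcs G \<Longrightarrow> head G (q a) = p (head G a)" by metis
    have injp: "inj_on p (verts G)" and imp: "p ` verts G = verts G"
      using p by (auto simp: bij_betw_def)
    have injq: "inj_on q (arcs G)"
    proof (rule inj_onI)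
      fix a b assume ab: "a \<in> arcs G" "b \<in> arcs G" "q a = q b"
      then have "p (tail G a) = p (tail G b)" "p (head G a) = p (head G b)" using q by metis+
      then have "tail G a = tail G b" "head G a = head G b" using injp ab by (auto dest: inj_onD)
      then show "a = b" using ab no_multi_arcs by (auto simp: arc_to_ends_def)
    qed
    have imq: "q ` arcs G = arcs G"
      using injq q(1) by (intro endo_inj_surj) auto
    let ?f = "\<lparr>iso_verts = p, iso_arcs = q, iso_head = head G, iso_tail = tail G\<rparr>"
    have "digraph_isomorphism ?f"
      using injp injq q by (auto simp: digraph_isomorphism_def wf_digraph)
    moreover have "app_iso ?f G = G"
      by (rule pre_digraph.equality) (auto simp: imp imq app_iso_def)
    ultimately show ?thesis
      by (intro exI[of _ ?f]) (simp add: automorphism_def)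
  qed
  show ?thesis unfolding vertex_transitive_def using 1 2 by (metis (no_types, lifting))
qed

text \<open>
  Rows and columns are numbered by an enumeration \<open>vs\<close> of the vertices.  Entries are complex, so
  that reality of the eigenvalues is not presupposed.
\<close>

definition adjacency_mat :: "('a,'b) pre_digraph \<Rightarrow> 'a list \<Rightarrow> complex mat" where
  "adjacency_mat G vs =
     mat (length vs) (length vs) (\<lambda>(i,j). if vs ! i \<rightarrow>\<^bsub>G\<^esub> vs ! j then 1 else 0)"

definition degree_mat :: "('a,'b) pre_digraph \<Rightarrow> 'a list \<Rightarrow> complex mat" where
  "degree_mat G vs = mat_diag (length vs) (\<lambda>i. of_nat (out_degree G (vs ! i)))"

text \<open>
  \<^const>\<open>mat_inverse\<close> returns \<^const>\<open>None\<close> on singular matrices; \<^const>\<open>degree_mat\<close> is invertible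
  exactly when there are no isolated vertices.
\<close>

definition normalized_adjacency_mat :: "('a,'b) pre_digraph \<Rightarrow> 'a list \<Rightarrow> complex mat" where
  "normalized_adjacency_mat G vs = the (mat_inverse (degree_mat G vs)) * adjacency_mat G vs"

lemma normalized_adjacency_mat_eq:
  assumes nz: "\<forall>v\<in>set vs. out_degree G v \<noteq> 0"
  shows "normalized_adjacency_mat G vs =
    mat (length vs) (length vs)
      (\<lambda>(i,j). if vs ! i \<rightarrow>\<^bsub>G\<^esub> vs ! j then 1 / of_nat (out_degree G (vs ! i)) else 0)"
proof -
  let ?n = "length vs" and ?D = "degree_mat G vs"
  let ?E = "mat_diag ?n (\<lambda>i. 1 / of_nat (out_degree G (vs ! i))) :: complex mat"
  have D: "?D \<in> carrier_mat ?n ?n" and E: "?E \<in> carrier_mat ?n ?n"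
    by (auto simp: degree_mat_def mat_diag_def)
  have DE: "?D * ?E = 1\<^sub>m ?n" and ED: "?E * ?D = 1\<^sub>m ?n"
    unfolding degree_mat_def mat_diag_diag
    using nz nth_mem by (fastforce simp: mat_diag_def intro!: eq_matI)+
  have "?D \<in> Units (ring_mat TYPE(complex) ?n ())"
    unfolding Units_def using D E DE ED by (auto simp: ring_mat_simps)
  then obtain B where B: "mat_inverse ?D = Some B"
    using mat_inverse(1)[OF D, of "()"] by (cases "mat_inverse ?D") auto
  have BD: "B * ?D = 1\<^sub>m ?n" and Bc: "B \<in> carrier_mat ?n ?n"
    using mat_inverse(2)[OF D B] by auto
  have "B = B * (?D * ?E)" using Bc DE by simp
  also have "\<dots> = ?E" using assoc_mult_mat[OF Bc D E] BD E by simp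
  finally have BE: "B = ?E" .
  have A: "adjacency_mat G vs \<in> carrier_mat ?n ?n" by (simp add: adjacency_mat_def)
  show ?thesis
    unfolding normalized_adjacency_mat_def B option.sel BE mat_diag_mult_left[OF A]
    by (auto simp: adjacency_mat_def intro!: eq_matI)
qed

definition simple_eigenvalue :: "complex mat \<Rightarrow> complex \<Rightarrow> bool" where
  "simple_eigenvalue M \<mu> \<longleftrightarrow> eigenvalue M \<mu> \<and> Polynomial.order \<mu> (char_poly M) = 1"

end

theory Submission
  imports Defs "Jordan_Normal_Form.Jordan_Normal_Form_Uniqueness"
    "Jordan_Normal_Form.Jordan_Normal_Form_Existence"
begin

text \<open>
  The eigenspace of a simple eigenvalue is a line, spanned by some eigenfunction \<open>f\<close>.  The adjacency
  matrix is real symmetric, so \<open>f\<close> may be taken real.  An automorphism maps \<open>f\<close> to a multiple of \<open>f\<close>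
  and preserves \<open>\<Sum>\<bar>f x\<bar>\<close>, so \<open>\<bar>f\<bar>\<close> is invariant, and by transitivity constant; after scaling,
  \<open>f\<close> takes values in \<open>{1, -1}\<close>.  At a vertex \<open>x\<close> with \<open>f x = 1\<close> and \<open>k\<close> neighbours of value \<open>1\<close>,
  the eigenvalue equation reads \<open>d * \<mu> = k - (d - k)\<close>.
\<close>

section \<open>Eigenfunctions of an adjacency relation\<close>

lemma sum_signs:
  fixes h :: "'a \<Rightarrow> complex"
  assumes "finite N" and "\<And>y. y \<in> N \<Longrightarrow> h y = 1 \<or> h y = -1"
  shows "(\<Sum>y\<in>N. h y) = 2 * of_nat (card {y\<in>N. h y = 1}) - of_nat (card N)"
proof -
  have "(\<Sum>y\<in>N. h y) = (\<Sum>y\<in>N. 2 * (if h y = 1 then 1 else 0) - 1)"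
    using assms(2) by (intro sum.cong) auto
  also have "\<dots> = 2 * (\<Sum>y\<in>N. if h y = 1 then 1 else 0) - of_nat (card N)"
    by (simp add: sum_subtractf flip: sum_distrib_left)
  also have "(\<Sum>y\<in>N. if h y = 1 then 1 else 0 :: complex) = of_nat (card {y\<in>N. h y = 1})"
    using assms(1) by (simp add: sum.If_cases Int_def)
  finally show ?thesis .
qed

definition eigenfunction :: "'a set \<Rightarrow> ('a \<Rightarrow> 'a \<Rightarrow> bool) \<Rightarrow> complex \<Rightarrow> ('a \<Rightarrow> complex) \<Rightarrow> bool" where
  "eigenfunction V R \<theta> f \<longleftrightarrow> (\<forall>x\<in>V. (\<Sum>y | y \<in> V \<and> R x y. f y) = \<theta> * f x)"

lemma eigenfunction_scale:
  "eigenfunction V R \<theta> f \<Longrightarrow> eigenfunction V R \<theta> (\<lambda>x. c * f x)"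
  by (simp add: eigenfunction_def flip: sum_distrib_left)

text \<open>Since \<open>p\<close> maps the neighbours of \<open>x\<close> bijectively onto those of
  \<open>p x\<close>, the equation for \<open>f\<close> at \<open>p x\<close> is the one for the
  composite at \<open>x\<close>.\<close>

lemma eigenfunction_compose:
  assumes f: "eigenfunction V R \<theta> f" and p: "bij_betw p V V"
    and adj: "\<And>x y. x \<in> V \<Longrightarrow> y \<in> V \<Longrightarrow> R x y \<longleftrightarrow> R (p x) (p y)"
  shows "eigenfunction V R \<theta> (\<lambda>x. f (p x))"
  unfolding eigenfunction_def
proof
  fix x assume x: "x \<in> V"
  then have px: "p x \<in> V" using p by (auto simp: bij_betw_def)
  have "p ` {y\<in>V. R x y} = {y\<in>V. R (p x) y}"
  proof (intro equalityI subsetI)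
    fix z assume z: "z \<in> {y\<in>V. R (p x) y}"
    then obtain y where "y \<in> V" "z = p y" using p by (auto simp: bij_betw_def)
    then show "z \<in> p ` {y\<in>V. R x y}" using z adj[OF x] by blast
  qed (use p adj x in \<open>auto simp: bij_betw_def\<close>)
  then have "bij_betw p {y\<in>V. R x y} {y\<in>V. R (p x) y}"
    by (intro bij_betw_subset[OF p]) auto
  then have "(\<Sum>y | y \<in> V \<and> R x y. f (p y)) = (\<Sum>y | y \<in> V \<and> R (p x) y. f y)"
    by (rule sum.reindex_bij_betw)
  with f px show "(\<Sum>y | y \<in> V \<and> R x y. f (p y)) = \<theta> * f (p x)"
    by (simp add: eigenfunction_def)
qed

text \<open>Two evaluations of one Hermitian form: the eigenvalue equation makes it
  \<open>\<theta>\<close> times the squared norm of \<open>f\<close>, and symmetry of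
  \<open>R\<close> makes it real. The norm is positive because of \<open>x0\<close>, so it
  cancels.\<close>

lemma eigenfunction_real:
  assumes fin: "finite V" and sym: "\<And>x y. R x y \<Longrightarrow> R y x"
    and f: "eigenfunction V R \<theta> f" and x0: "x0 \<in> V" "f x0 \<noteq> 0"
  shows "cnj \<theta> = \<theta>"
proof -
  \<comment> \<open>\<open>Q\<close> is the Hermitian form \<open>\<langle>f, A f\<rangle>\<close>, which is real because \<open>A\<close> is symmetric.\<close>
  define Q where "Q = (\<Sum>x\<in>V. cnj (f x) * (\<Sum>y | y \<in> V \<and> R x y. f y))"
  define N where "N = (\<Sum>x\<in>V. (cmod (f x))\<^sup>2)"
  have "Q = (\<Sum>x\<in>V. cnj (f x) * (\<theta> * f x))"
    unfolding Q_def using f by (intro sum.cong refl) (simp add: eigenfunction_def)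
  then have Q: "Q = \<theta> * of_real N"
    by (simp add: N_def sum_distrib_left complex_norm_square mult_ac del: of_real_power)
  have Q2: "Q = (\<Sum>x\<in>V. \<Sum>y\<in>V. if R x y then cnj (f x) * f y else 0)"
    unfolding Q_def sum_distrib_left using fin
    by (simp add: sum.inter_filter)
  have "cnj Q = (\<Sum>x\<in>V. \<Sum>y\<in>V. if R x y then f x * cnj (f y) else 0)"
    unfolding Q2 cnj_sum by (intro sum.cong refl) simp
  also have "\<dots> = (\<Sum>y\<in>V. \<Sum>x\<in>V. if R x y then f x * cnj (f y) else 0)"
    by (rule sum.swap)
  also have "\<dots> = Q"
    unfolding Q2 using sym by (intro sum.cong refl) (auto simp: mult.commute)
  finally have "cnj \<theta> * of_real N = \<theta> * of_real N" unfolding Q by simp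
  moreover have "N > 0"
    unfolding N_def using fin x0 by (intro sum_pos2[of V x0]) auto
  ultimately show ?thesis by simp
qed

lemma eigenfunction_cnj:
  assumes f: "eigenfunction V R \<theta> f" and "cnj \<theta> = \<theta>"
  shows "eigenfunction V R \<theta> (\<lambda>x. cnj (f x))"
  unfolding eigenfunction_def
proof
  fix x assume "x \<in> V"
  then have "cnj (\<Sum>y | y \<in> V \<and> R x y. f y) = cnj (\<theta> * f x)"
    using f by (simp add: eigenfunction_def)
  then show "(\<Sum>y | y \<in> V \<and> R x y. cnj (f y)) = \<theta> * cnj (f x)"
    using assms(2) by simp
qed

text \<open>The argument free of matrices: \<open>\<theta>\<close> stands for
  \<open>d * \<mu>\<close>, and simplicity takes the form that the eigenspace is the line through
  \<open>f\<close>.\<close>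

lemma vertex_transitive_simple_eigenfunction:
  assumes fin: "finite V" and sym: "\<And>x y. R x y \<Longrightarrow> R y x"
    and deg: "\<And>x. x \<in> V \<Longrightarrow> card {y\<in>V. R x y} = d"
    and trans: "\<And>u v. u \<in> V \<Longrightarrow> v \<in> V \<Longrightarrow>
      \<exists>p. bij_betw p V V \<and> (\<forall>x\<in>V. \<forall>y\<in>V. R x y \<longleftrightarrow> R (p x) (p y)) \<and> p u = v"
    and f: "eigenfunction V R \<theta> f" and x0: "x0 \<in> V" "f x0 \<noteq> 0"
    and simple: "\<And>g. eigenfunction V R \<theta> g \<Longrightarrow> \<exists>c. \<forall>x\<in>V. g x = c * f x"
  shows "\<exists>k\<le>d. \<theta> = 2 * of_nat k - of_nat d"
proof -
  \<comment> \<open>With value 1 at \<open>x0\<close>, the factor between \<open>h\<close> and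
    another eigenfunction is the value of the latter at \<open>x0\<close>.\<close>
  define h where "h x = inverse (f x0) * f x" for x
  have h: "eigenfunction V R \<theta> h" unfolding h_def using f by (rule eigenfunction_scale)
  have h0: "h x0 = 1" using x0 by (simp add: h_def)
  have multiple: "\<exists>c. \<forall>x\<in>V. g x = c * h x" if "eigenfunction V R \<theta> g" for g
  proof -
    obtain c where "\<forall>x\<in>V. g x = c * f x" using simple \<open>eigenfunction V R \<theta> g\<close> by blast
    then show ?thesis using x0 by (intro exI[of _ "c * f x0"]) (simp add: h_def)
  qed
  have "cnj \<theta> = \<theta>" using fin sym f x0 by (rule eigenfunction_real)
  then obtain c where c: "\<forall>x\<in>V. cnj (h x) = c * h x"
    using multiple eigenfunction_cnj[OF h] by blast
  with h0 x0 have "c = 1" by force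
  with c have real: "h x \<in> \<real>" if "x \<in> V" for x using that by (simp add: Reals_cnj_iff)
  have norm: "cmod (h v) = 1" if "v \<in> V" for v
  proof -
    obtain p where p: "bij_betw p V V" "\<And>x y. x \<in> V \<Longrightarrow> y \<in> V \<Longrightarrow> R x y \<longleftrightarrow> R (p x) (p y)"
      "p x0 = v" using trans[OF x0(1) \<open>v \<in> V\<close>] by blast
    obtain c where c: "\<forall>x\<in>V. h (p x) = c * h x"
      using multiple[OF eigenfunction_compose[OF h p(1,2)]] by blast
    have "(\<Sum>x\<in>V. cmod (h x)) = (\<Sum>x\<in>V. cmod (h (p x)))"
      using sum.reindex_bij_betw[OF p(1), of "\<lambda>x. cmod (h x)"] by simp
    also have "\<dots> = cmod c * (\<Sum>x\<in>V. cmod (h x))"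
      using c by (simp add: norm_mult sum_distrib_left)
    moreover have "(\<Sum>x\<in>V. cmod (h x)) > 0"
      using fin x0 h0 by (intro sum_pos2[of V x0]) auto
    ultimately have "cmod c = 1" by simp
    \<comment> \<open>At \<open>x0\<close> the relation reads \<open>h v = c\<close>.\<close>
    then show ?thesis using c x0 h0 p(3) by force
  qed
  have pm: "h x = 1 \<or> h x = -1" if "x \<in> V" for x
  proof -
    obtain r where "h x = of_real r" using real[OF \<open>x \<in> V\<close>] by (elim Reals_cases)
    with norm[OF \<open>x \<in> V\<close>] show ?thesis by (auto simp: abs_if split: if_splits)
  qed
  let ?N = "{y\<in>V. R x0 y}"
  \<comment> \<open>This is the eigenvalue equation at \<open>x0\<close>, where \<open>h\<close> is
    1.\<close>
  have "\<theta> = (\<Sum>y\<in>?N. h y)" using h x0(1) h0 by (simp add: eigenfunction_def)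
  also have "\<dots> = 2 * of_nat (card {y\<in>?N. h y = 1}) - of_nat (card ?N)"
    using fin pm by (intro sum_signs) auto
  finally have "\<theta> = 2 * of_nat (card {y\<in>?N. h y = 1}) - of_nat d" using deg x0(1) by simp
  moreover have "card {y\<in>?N. h y = 1} \<le> d"
    using card_mono[of ?N "{y\<in>?N. h y = 1}"] fin deg[OF x0(1)] by auto
  ultimately show ?thesis by blast
qed

section \<open>Algebraic and geometric multiplicity\<close>

text \<open>
  In a Jordan normal form, the geometric multiplicity counts the blocks of an eigenvalue, and the
  algebraic multiplicity adds up their sizes.
\<close>

lemma kernel_dim_char_matrix_le_order:
  fixes A :: "complex mat"
  assumes A: "A \<in> carrier_mat n n"
  shows "kernel_dim (char_matrix A \<mu>) \<le> Polynomial.order \<mu> (char_poly A)"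
proof -
  \<comment> \<open>Over the complex numbers the characteristic polynomial splits into linear
    factors, as the existence of a Jordan normal form requires.\<close>
  obtain as where "char_poly A = (\<Prod>a\<leftarrow>as. [:- a, 1:])"
    using char_poly_factorized[OF A] by auto
  from jordan_nf_exists[OF A this] obtain n_as where jnf: "jordan_nf A n_as" ..
  have C: "char_matrix A \<mu> \<in> carrier_mat n n" using A by simp
  have "kernel_dim (char_matrix A \<mu>) = dim_gen_eigenspace A \<mu> 1"
    using C by (simp add: dim_gen_eigenspace_def)
  also have "\<dots> = (\<Sum>n \<leftarrow> map fst [(n, e)\<leftarrow>n_as . e = \<mu>]. min 1 n)"
    by (rule dim_gen_eigenspace[OF jnf])
  also have "\<dots> \<le> (\<Sum>n \<leftarrow> map fst [(n, e)\<leftarrow>n_as . e = \<mu>]. n)"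
    by (rule sum_list_mono) simp
  also have "\<dots> = Polynomial.order \<mu> (char_poly A)"
    unfolding jordan_nf_order[OF jnf] by (simp add: case_prod_unfold)
  finally show ?thesis .
qed

text \<open>Algebraic multiplicity one bounds the dimension of the kernel of
  \<open>char_matrix A \<mu>\<close> by one, and the nonzero \<open>v\<close> already lies in it.
  For \<open>w\<close> only the equation is assumed, so that \<open>w\<close> may be zero.\<close>

lemma simple_eigenvalue_eigenvectors:
  assumes A: "A \<in> carrier_mat n n" and simple: "simple_eigenvalue A \<mu>"
    and v: "eigenvector A v \<mu>"
    and w: "w \<in> carrier_vec n" "A *\<^sub>v w = \<mu> \<cdot>\<^sub>v w"
  shows "\<exists>c. w = c \<cdot>\<^sub>v v"
proof -
  let ?C = "char_matrix A \<mu>"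
  have C: "?C \<in> carrier_mat n n" using A by simp
  interpret K: kernel n n ?C by unfold_locales (rule C)
  have v': "v \<in> mat_kernel ?C" "v \<noteq> 0\<^sub>v n"
    using v C by (auto simp: eigenvector_char_matrix[OF A] mat_kernel)
  have w': "w \<in> mat_kernel ?C"
  proof (cases "w = 0\<^sub>v n")
    case True
    then show ?thesis using C by (auto intro!: mat_kernelI)
  next
    case False
    then have "eigenvector A w \<mu>" using A w by (auto simp: eigenvector_def)
    then show ?thesis using C by (auto simp: eigenvector_char_matrix[OF A] mat_kernel)
  qed
  obtain B where B: "finite B" "K.basis B" using kernel_basis_exists[OF C] by auto
  have "card B \<le> 1"
    using kernel_dim_char_matrix_le_order[OF A, of \<mu>] simple K.Ker.dim_basis[OF B]
    by (simp add: simple_eigenvalue_def)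
  have span: "K.span B = mat_kernel ?C" and sub: "B \<subseteq> mat_kernel ?C"
    using B(2) by (auto simp: K.Ker.basis_def)
  \<comment> \<open>An empty basis would span only the zero vector, but \<open>v\<close> is a
    nonzero element of the kernel.\<close>
  have "B \<noteq> {}" using span v' K.Ker.span_empty by auto
  with \<open>card B \<le> 1\<close> B(1) obtain b where b: "B = {b}"
    by (metis One_nat_def card_1_singletonE card_gt_0_iff le_antisym Suc_leI)
  have multiple: "\<exists>a. u = a \<cdot>\<^sub>v b" if "u \<in> mat_kernel ?C" for u
  proof -
    have "u \<in> K.span {b}" using that span b by simp
    then obtain a where "u = K.lincomb a {b}"
      using K.Ker.finite_span[OF B(1) sub] unfolding b by blast
    then show ?thesis using sub unfolding b by (auto simp: K.Ker.lincomb_def)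
  qed
  obtain s t where s: "v = s \<cdot>\<^sub>v b" and t: "w = t \<cdot>\<^sub>v b" using multiple v' w' by blast
  have "b \<in> carrier_vec n" using sub b mat_kernel[OF C] by auto
  then have "s \<noteq> 0" using s v' by auto
  then have "w = (t / s) \<cdot>\<^sub>v v" unfolding s t by (simp add: smult_smult_assoc)
  then show ?thesis ..
qed

section \<open>From the matrix to functions on the vertices\<close>

text \<open>In a regular graph the normalized matrix is the adjacency matrix divided by
  \<open>d\<close>, so the eigenvalue is multiplied by \<open>d\<close>. Distinctness of
  \<open>vs\<close> turns sums over indices into sums over vertices.\<close>

lemma normalized_adjacency_eigenvector_iff:
  assumes d: "d \<noteq> 0" "\<forall>v\<in>verts G. out_degree G v = d"
    and vs: "distinct vs" "set vs = verts G"
  shows "normalized_adjacency_mat G vs *\<^sub>v vec (length vs) (\<lambda>i. f (vs ! i))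
      = \<mu> \<cdot>\<^sub>v vec (length vs) (\<lambda>i. f (vs ! i))
    \<longleftrightarrow> eigenfunction (verts G) (\<lambda>x y. x \<rightarrow>\<^bsub>G\<^esub> y) (of_nat d * \<mu>) f" (is "?M *\<^sub>v ?v = _ \<longleftrightarrow> _")
proof -
  let ?n = "length vs"
  have M: "?M = mat ?n ?n (\<lambda>(i,j). if vs ! i \<rightarrow>\<^bsub>G\<^esub> vs ! j then 1 / of_nat d else 0)"
    using d vs(2) by (subst normalized_adjacency_mat_eq) (auto intro!: cong_mat)
  have bij: "bij_betw ((!) vs) {0..<?n} (verts G)"
    using bij_betw_nth[OF vs(1) refl vs(2)[symmetric]] by (simp add: atLeast0LessThan)
  have fin: "finite (verts G)" using vs(2) by (metis List.finite_set)
  have entry: "(?M *\<^sub>v ?v) $ i = (\<Sum>y | y \<in> verts G \<and> vs ! i \<rightarrow>\<^bsub>G\<^esub> y. f y) / of_nat d"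
    if i: "i < ?n" for i
  proof -
    have "(?M *\<^sub>v ?v) $ i = (\<Sum>j = 0..<?n. if vs ! i \<rightarrow>\<^bsub>G\<^esub> vs ! j then f (vs ! j) / of_nat d else 0)"
      unfolding M using i by (auto simp: scalar_prod_def intro!: sum.cong)
    also have "\<dots> = (\<Sum>y\<in>verts G. if vs ! i \<rightarrow>\<^bsub>G\<^esub> y then f y / of_nat d else 0)"
      by (rule sum.reindex_bij_betw[OF bij])
    also have "\<dots> = (\<Sum>y | y \<in> verts G \<and> vs ! i \<rightarrow>\<^bsub>G\<^esub> y. f y / of_nat d)"
      using fin by (simp add: sum.inter_filter)
    finally show ?thesis by (simp add: sum_divide_distrib)
  qed
  have "?M *\<^sub>v ?v = \<mu> \<cdot>\<^sub>v ?v \<longleftrightarrow> (\<forall>i<?n. (?M *\<^sub>v ?v) $ i = \<mu> * f (vs ! i))"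
    unfolding M by (auto simp: vec_eq_iff)
  also have "\<dots> \<longleftrightarrow> (\<forall>x\<in>verts G. (\<Sum>y | y \<in> verts G \<and> x \<rightarrow>\<^bsub>G\<^esub> y. f y) / of_nat d = \<mu> * f x)"
    using entry unfolding vs(2)[symmetric] all_set_conv_all_nth by (metis (no_types, lifting))
  finally show ?thesis using d(1) by (simp add: eigenfunction_def field_simps)
qed

text \<open>Without parallel arcs, distinct arcs leaving \<open>x\<close> have distinct
  heads.\<close>

lemma (in graph) card_out_neighbours:
  "card {y \<in> verts G. x \<rightarrow>\<^bsub>G\<^esub> y} = out_degree G x"
proof -
  have "{y \<in> verts G. x \<rightarrow>\<^bsub>G\<^esub> y} = head G ` out_arcs G x"
    by (auto simp: arcs_ends_conv)
  moreover have "inj_on (head G) (out_arcs G x)"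
    using no_multi_arcs by (auto simp: inj_on_def arc_to_ends_def)
  ultimately show ?thesis by (simp add: out_degree_def card_image)
qed

theorem theorem3:
  fixes G :: "('a,'b) pre_digraph" and vs :: "'a list" and d :: nat and \<mu> :: complex
  assumes "graph G"
    and "\<forall>v\<in>verts G. out_degree G v \<noteq> 0"
    and "Digraph_Component.connected G"
    and "vertex_transitive G"
    and "\<forall>v\<in>verts G. out_degree G v = d"
    and "distinct vs" and "set vs = verts G"
    and "simple_eigenvalue (normalized_adjacency_mat G vs) \<mu>"
  shows "\<exists>k::int. 0 \<le> k \<and> k \<le> int d \<and> \<mu> = 2 * of_int k / of_nat d - 1"
proof -
  interpret graph G by (rule assms(1))
  let ?n = "length vs" and ?M = "normalized_adjacency_mat G vs"
  let ?R = "\<lambda>x y. x \<rightarrow>\<^bsub>G\<^esub> y"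
  have M: "?M \<in> carrier_mat ?n ?n"
    using assms(2,7) by (subst normalized_adjacency_mat_eq) auto
  obtain v where v: "eigenvector ?M v \<mu>"
    using assms(8) by (auto simp: simple_eigenvalue_def eigenvalue_def)
  then have dimv: "dim_vec v = ?n" and v0: "v \<noteq> 0\<^sub>v ?n" and Mv: "?M *\<^sub>v v = \<mu> \<cdot>\<^sub>v v"
    using M by (auto simp: eigenvector_def)
  \<comment> \<open>The vector \<open>v\<close> is read as a function on vertices by looking up the
    index of each vertex in \<open>vs\<close>.\<close>
  define f where "f x = v $ inv_into {..<?n} ((!) vs) x" for x
  have f: "f (vs ! i) = v $ i" if "i < ?n" for i
    using that assms(6) by (simp add: f_def inv_into_f_f inj_on_nth)
  then have fv: "vec ?n (\<lambda>i. f (vs ! i)) = v" using dimv by (intro eq_vecI) auto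
  obtain i where i: "i < ?n" "v $ i \<noteq> 0" using v0 dimv by (auto simp: vec_eq_iff)
  then have x0: "vs ! i \<in> verts G" "f (vs ! i) \<noteq> 0" using f assms(7) by auto
  \<comment> \<open>The nonzero eigenvector provides a vertex, and no vertex is isolated.\<close>
  have d0: "d \<noteq> 0" using x0(1) assms(2,5) by auto
  note iff = normalized_adjacency_eigenvector_iff[OF d0 assms(5-7), where \<mu> = \<mu>]
  have ef: "eigenfunction (verts G) ?R (of_nat d * \<mu>) f" using iff[of f] fv Mv by simp
  have simple: "\<exists>c. \<forall>x\<in>verts G. g x = c * f x"
    if "eigenfunction (verts G) ?R (of_nat d * \<mu>) g" for g
  proof -
    \<comment> \<open>Simplicity is a statement about the matrix, so \<open>g\<close> is turned back
      into a vector to compare it with \<open>v\<close>.\<close>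
    let ?g = "vec ?n (\<lambda>i. g (vs ! i))"
    have "?M *\<^sub>v ?g = \<mu> \<cdot>\<^sub>v ?g" using iff that by blast
    then obtain c where c: "?g = c \<cdot>\<^sub>v v"
      using simple_eigenvalue_eigenvectors[OF M assms(8) v vec_carrier] by blast
    have "g (vs ! i) = c * f (vs ! i)" if "i < ?n" for i
      using arg_cong[OF c, of "\<lambda>u. u $ i"] that dimv f by simp
    then show ?thesis unfolding assms(7)[symmetric] all_set_conv_all_nth by blast
  qed
  have "\<exists>k\<le>d. of_nat d * \<mu> = 2 * of_nat k - of_nat d"
  proof (rule vertex_transitive_simple_eigenfunction[OF _ _ _ _ ef x0 simple])
    show "?R y x" if "?R x y" for x y
      using that by (rule graph_symmetric)
    show "card {y \<in> verts G. ?R x y} = d" if "x \<in> verts G" for x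
      using that assms(5) card_out_neighbours by auto
    show "\<exists>p. bij_betw p (verts G) (verts G) \<and>
        (\<forall>x\<in>verts G. \<forall>y\<in>verts G. ?R x y \<longleftrightarrow> ?R (p x) (p y)) \<and> p u = w"
      if "u \<in> verts G" "w \<in> verts G" for u w
      using assms(4) that unfolding vertex_transitive_iff[OF assms(1)] by blast
  qed auto
  then obtain k where k: "k \<le> d" "of_nat d * \<mu> = 2 * of_nat k - of_nat d" by blast
  then have "\<mu> = 2 * of_int (int k) / of_nat d - 1" using d0 by (simp add: field_simps)
  with k(1) show ?thesis by (intro exI[of _ "int k"]) auto
qed

end
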